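(* Fix $n\in\mathbb{N}_{>0}$ and a distribution $D$ as in the model described in the context. For $k=0,1,\dots,n$ let $\bm{G}_k$ be the supremum, over all online algorithms, of the expected total value on an instance with $k$ steps and i.i.d. values drawn from $D$ (so $\bm{G}_0=0$), and put $\tau_0=0$ and $\tau_k=\bm{G}_k/k$ for $k\ge 1$. Consider the online algorithm which, for $i=1,\dots,n$: if $x_i>\tau_{n-i}$, selects $x_i$ for all $n-i+1$ remaining steps (i.e. $t_i=n-i+1$) and stops; otherwise selects $x_i$ only in step $i$ (i.e. $t_i=1$). Then this algorithm is an optimal online algorithm, i.e. its expected total value equals $\bm{G}_n$ and is at least the expected total value of every online algorithm.
   Context: Model (prophet-inequality over time). Fix $n\in\mathbb{N}_{>0}$ and a continuous distribution $D$ with density $f$ and cumulative distribution function $F$, supported on non-negative numbers ($F(0)=0$), with finite expectation. Random variables $x_1,\dots,x_n$ are i.i.d. with distribution $D$ and are revealed one by one. In step $i$, if step $i$ is not already covered by an earlier selection, the decider chooses a number $t_i\in\{1,\dots,n-i+1\}$ and gains $x_i$ for $t_i$ steps, so that steps $i,\dots,i+t_i-1$ become covered; if step $i$ is covered by an earlier selection (i.e. $i\le j+t_j-1$ for some $j<i$), then $t_i=0$. The total value is $\sum_{i=1}^n x_i t_i$. An online algorithm chooses $t_i$ knowing only $n$, $D$, $x_1,\dots,x_i$ and $t_1,\dots,t_{i-1}$. *)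

theory Defs
  imports "HOL-Probability.Probability"
begin

text \<open>
  A decision rule \<open>A\<close> maps a step \<open>i\<close>, the observed values \<open>x\<^sub>1, \<dots>, x\<^sub>i\<close> and the earlier
  choices \<open>t\<^sub>1, \<dots>, t\<^bsub>i-1\<^esub>\<close> to the choice made in step \<open>i\<close> in case that step is not yet covered.
  Histories are extensional functions on \<open>{1..i}\<close> and \<open>{1..<i}\<close>.
\<close>

type_synonym rule = "nat \<Rightarrow> (nat \<Rightarrow> real) \<Rightarrow> (nat \<Rightarrow> nat) \<Rightarrow> nat"

text \<open>
  The target space bundles the range condition \<open>t\<^sub>i \<in> {1..n - i + 1}\<close> with measurability. The
  output of \<open>A\<close> on a history in which step \<open>i\<close> is already covered is ignored by \<open>duration\<close> below.
\<close>

definition online_algorithm :: "nat \<Rightarrow> rule \<Rightarrow> bool" where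
  "online_algorithm n A \<longleftrightarrow>
    (\<forall>i\<in>{1..n}. (\<lambda>(x, t). A i x t) \<in>
       (\<Pi>\<^sub>M j\<in>{1..i}. (borel :: real measure)) \<Otimes>\<^sub>M (\<Pi>\<^sub>M j\<in>{1..<i}. count_space UNIV)
         \<rightarrow>\<^sub>M count_space {1..n - i + 1})"

lemma restrict_fundef_cong [fundef_cong]:
  assumes "I = J" "\<And>j. j \<in> J \<Longrightarrow> g j = h j"
  shows "restrict g I = restrict h J"
  using assms by (auto simp: restrict_def)

text \<open>
  The number \<open>t\<^sub>i\<close> of steps for which \<open>x\<^sub>i\<close> is collected when \<open>A\<close> is run on \<open>x\<close>. It depends only on
  \<open>x\<^sub>1, \<dots>, x\<^sub>i\<close>, because \<open>A\<close> is only applied to restricted histories. For \<open>t\<^sub>j = 0\<close> the covering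
  condition is false, as \<open>1 \<le> j < i\<close>.
\<close>

function duration :: "rule \<Rightarrow> (nat \<Rightarrow> real) \<Rightarrow> nat \<Rightarrow> nat" where
  "duration A x i =
    (if \<exists>j\<in>{1..<i}. i \<le> j + duration A x j - 1 then 0
     else A i (restrict x {1..i}) (\<lambda>j\<in>{1..<i}. duration A x j))"
  by pat_completeness auto
termination
  by (relation "Wellfounded.measure (\<lambda>(A, x, i). i)") auto

declare duration.simps [simp del]

definition total_value :: "nat \<Rightarrow> rule \<Rightarrow> (nat \<Rightarrow> real) \<Rightarrow> real" where
  "total_value n A x = (\<Sum>i=1..n. x i * real (duration A x i))"

definition expected_value ::
    "'a measure \<Rightarrow> (nat \<Rightarrow> 'a \<Rightarrow> real) \<Rightarrow> nat \<Rightarrow> rule \<Rightarrow> real" where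
  "expected_value M X n A = (\<integral>\<omega>. total_value n A (\<lambda>i. X i \<omega>) \<partial>M)"

text \<open>
  The value \<open>G\<^sub>k\<close>, on the canonical model of \<open>k\<close> independent draws from \<open>D\<close>. If \<open>D\<close> has a finite
  expectation, all total values are integrable and the supremum is over a bounded set.
\<close>

definition opt_value :: "real measure \<Rightarrow> nat \<Rightarrow> real" where
  "opt_value D k =
    (SUP A \<in> Collect (online_algorithm k).
       expected_value (\<Pi>\<^sub>M j\<in>{1..k}. D) (\<lambda>i \<omega>. \<omega> i) k A)"

definition threshold :: "real measure \<Rightarrow> nat \<Rightarrow> real" where
  "threshold D k = (if k = 0 then 0 else opt_value D k / real k)"

text \<open>
  Stopping after a selection for all \<open>n - i + 1\<close> remaining steps is automatic, since it covers them.
\<close>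

definition threshold_algorithm :: "real measure \<Rightarrow> nat \<Rightarrow> rule" where
  "threshold_algorithm D n i x t = (if x i > threshold D (n - i) then n - i + 1 else 1)"

end

(*
Let G 0 = 0 and G (k + 1) = E (y + max (G k) (k y)), the value of choosing optimally between one step
and all remaining steps. By induction on k, G k / k is nondecreasing. Hence taking y for one step and
then s \<le> m further steps gains at most y + max (G m) (m y): the intermediate durations are
dominated, and the maximum is attained by the comparison of y with the threshold G m / m.

For every online algorithm, the total value telescopes to G n plus the surplus of each uncovered step
over the value G of the remaining steps. This surplus is at most y + max (G m) (m y) - G (m + 1), with
equality for the threshold algorithm. The bound has mean zero and is independent of the event that
the step is uncovered, so every expected value is at most G n, and the threshold algorithm attains it.
That the thresholds computed from G are those of the supremum follows by strong induction on k.
*)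

theory Submission
  imports Defs
begin

section \<open>The recursive optimal values and the growth of their averages\<close>

primrec stage_value :: "real measure \<Rightarrow> nat \<Rightarrow> real" where
  "stage_value D 0 = 0"
| "stage_value D (Suc k) = (\<integral>y. y + max (stage_value D k) (real k * y) \<partial>D)"

lemma integrable_stage:
  assumes "prob_space D" "integrable D (\<lambda>y. y)"
  shows "integrable D (\<lambda>y. y + max c (real k * y))"
proof -
  interpret prob_space D by fact
  show ?thesis using assms(2) by (intro Bochner_Integration.integrable_add integrable_max) auto
qed

text \<open>Cross-multiplied, so that \<open>k = 0\<close> involves no division. The induction
  hypothesis, scaled inside the integrand, gives a pointwise inequality whose integral is the next
  case.\<close>

lemma stage_value_Suc_mono:
  assumes D: "prob_space D" "integrable D (\<lambda>y. y)"
  shows "real (Suc k) * stage_value D k \<le> real k * stage_value D (Suc k)"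
proof (induction k)
  case 0
  show ?case by simp
next
  case (Suc k)
  interpret prob_space D by fact
  define a where "a = stage_value D (Suc k)"
  define b where "b = stage_value D k"
  \<comment> \<open>The integral of \<open>y + max b (k * y)\<close> is \<open>a\<close>, so after
    integration the extra \<open>a\<close> raises the coefficient of \<open>a\<close> on the left
    from \<open>k + 1\<close> to \<open>k + 2\<close>.\<close>
  have pointwise: "real (Suc k) * (y + max b (real k * y)) + a
      \<le> real (Suc k) * (y + max a (real (Suc k) * y))" for y
  proof -
    \<comment> \<open>Scaling by \<open>k + 1\<close> turns \<open>b\<close> into
      \<open>(k + 1) * b\<close>, at most \<open>k * a\<close> by the induction hypothesis; then
      \<open>k\<close> factors out of the maximum. The extra \<open>a\<close> is absorbed by one
      further copy of that maximum.\<close>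
    have "real (Suc k) * max b (real k * y) = max (real (Suc k) * b) (real k * (real (Suc k) * y))"
      by (simp add: max_mult_distrib_left mult_ac)
    also have "\<dots> \<le> max (real k * a) (real k * (real (Suc k) * y))"
      using Suc by (intro max.mono) (auto simp: a_def b_def)
    also have "\<dots> = real k * max a (real (Suc k) * y)"
      by (simp add: max_mult_distrib_left)
    finally have "real (Suc k) * max b (real k * y) + a
        \<le> real k * max a (real (Suc k) * y) + max a (real (Suc k) * y)"
      by linarith
    then show ?thesis by (simp add: algebra_simps)
  qed
  have "real (Suc (Suc k)) * a = real (Suc k) * (\<integral>y. y + max b (real k * y) \<partial>D) + a"
    by (simp add: a_def b_def algebra_simps)
  also have "\<dots> = (\<integral>y. real (Suc k) * (y + max b (real k * y)) + a \<partial>D)"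
    using integrable_stage[OF D, of b k] by (simp add: prob_space del: of_nat_Suc)
  also have "\<dots> \<le> (\<integral>y. real (Suc k) * (y + max a (real (Suc k) * y)) \<partial>D)"
    using integrable_stage[OF D, of b k] integrable_stage[OF D, of a "Suc k"] pointwise
    by (intro integral_mono) auto
  also have "\<dots> = real (Suc k) * stage_value D (Suc (Suc k))"
    by (simp add: a_def del: of_nat_Suc)
  finally show ?case by (simp add: a_def)
qed

lemma stage_value_ratio_mono:
  assumes D: "prob_space D" "integrable D (\<lambda>y. y)" and "l \<le> k"
  shows "real k * stage_value D l \<le> real l * stage_value D k"
  using \<open>l \<le> k\<close>
proof (induction k rule: dec_induct)
  case base
  show ?case by simp
next
  case (step k)
  show ?case
  proof (cases "k = 0")
    case True
    then show ?thesis using step by simp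
  next
    case False
    \<comment> \<open>The factor \<open>k\<close> lets the two inequalities chain and is cancelled
      at the end, which is why \<open>k = 0\<close> is split off.\<close>
    have "real k * (real (Suc k) * stage_value D l) = real (Suc k) * (real k * stage_value D l)"
      by simp
    also have "\<dots> \<le> real (Suc k) * (real l * stage_value D k)"
      using step.IH by (intro mult_left_mono) auto
    also have "\<dots> = real l * (real (Suc k) * stage_value D k)" by simp
    also have "\<dots> \<le> real l * (real k * stage_value D (Suc k))"
      using stage_value_Suc_mono[OF D] by (intro mult_left_mono) auto
    also have "\<dots> = real k * (real l * stage_value D (Suc k))" by simp
    finally show ?thesis using False by (simp add: mult_le_cancel_left_pos del: stage_value.simps)
  qed
qed

text \<open>For \<open>m > 0\<close>, ratio monotonicity bounds the left side by a convex
  combination of \<open>m * y\<close> and \<open>stage_value D m\<close> with weights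
  \<open>s / m\<close> and \<open>(m - s) / m\<close>, hence by their maximum.\<close>

lemma stage_choice_le:
  assumes D: "prob_space D" "integrable D (\<lambda>y. y)" and "s \<le> m"
  shows "real s * y + stage_value D (m - s) \<le> max (stage_value D m) (real m * y)"
proof (cases "m = 0")
  case True
  then show ?thesis using \<open>s \<le> m\<close> by simp
next
  case False
  let ?c = "max (stage_value D m) (real m * y)"
  have "real m * (real s * y + stage_value D (m - s))
      = real s * (real m * y) + real m * stage_value D (m - s)"
    by (simp add: algebra_simps)
  also have "\<dots> \<le> real s * (real m * y) + real (m - s) * stage_value D m"
    using stage_value_ratio_mono[OF D, of "m - s" m] by simp
  also have "\<dots> \<le> real s * ?c + real (m - s) * ?c"
    by (intro add_mono mult_left_mono) auto
  also have "\<dots> = real m * ?c" using \<open>s \<le> m\<close> by (simp add: of_nat_diff algebra_simps)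
  finally show ?thesis using False by (simp add: mult_le_cancel_left_pos)
qed

section \<open>Coverage, durations and their measurability\<close>

definition uncovered :: "rule \<Rightarrow> (nat \<Rightarrow> real) \<Rightarrow> nat \<Rightarrow> bool" where
  "uncovered A x i \<longleftrightarrow> (\<forall>j\<in>{1..<i}. j + duration A x j - 1 < i)"

lemma duration_eq:
  "duration A x i = (if uncovered A x i
     then A i (restrict x {1..i}) (\<lambda>j\<in>{1..<i}. duration A x j) else 0)"
  by (subst duration.simps) (auto simp: uncovered_def not_le)

lemma duration_cong:
  "(\<And>j. j \<in> {1..i} \<Longrightarrow> x j = y j) \<Longrightarrow> duration A x i = duration A y i"
proof (induction i rule: less_induct)
  case (less i)
  have *: "duration A x j = duration A y j" if "j \<in> {1..<i}" for j
    using that less.prems by (intro less.IH) auto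
  have "uncovered A x i = uncovered A y i"
    using * by (simp add: uncovered_def)
  moreover have "restrict x {1..i} = restrict y {1..i}"
    using less.prems by (auto simp: restrict_def)
  moreover have "(\<lambda>j\<in>{1..<i}. duration A x j) = (\<lambda>j\<in>{1..<i}. duration A y j)"
    using * by (auto simp: restrict_def)
  ultimately show ?case by (simp add: duration_eq[of A x i] duration_eq[of A y i])
qed

text \<open>Only durations before \<open>i\<close> enter, and each depends on values up to its own
  step. The strict range is the source of the independence from \<open>X i\<close> below.\<close>

lemma uncovered_cong:
  "(\<And>j. j \<in> {1..<i} \<Longrightarrow> x j = y j) \<Longrightarrow> uncovered A x i = uncovered A y i"
proof -
  assume "\<And>j. j \<in> {1..<i} \<Longrightarrow> x j = y j"
  then have "duration A x j = duration A y j" if "j \<in> {1..<i}" for j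
    using that by (intro duration_cong) auto
  then show ?thesis by (simp add: uncovered_def)
qed

text \<open>A measurable map sends the space of its source into that of its target, and every
  restricted history lies in the product space.\<close>

lemma online_algorithm_range:
  assumes "online_algorithm n A" "i \<in> {1..n}"
  shows "A i (restrict x {1..i}) (\<lambda>j\<in>{1..<i}. t j) \<in> {1..n - i + 1}"
proof -
  have "(restrict x {1..i}, \<lambda>j\<in>{1..<i}. t j) \<in>
      space ((\<Pi>\<^sub>M j\<in>{1..i}. (borel :: real measure)) \<Otimes>\<^sub>M (\<Pi>\<^sub>M j\<in>{1..<i}. count_space UNIV))"
    by (auto simp: space_pair_measure space_PiM)
  moreover have "(\<lambda>(x, t). A i x t) \<in>
      (\<Pi>\<^sub>M j\<in>{1..i}. (borel :: real measure)) \<Otimes>\<^sub>M (\<Pi>\<^sub>M j\<in>{1..<i}. count_space UNIV)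
        \<rightarrow>\<^sub>M count_space {1..n - i + 1}"
    using assms unfolding online_algorithm_def by blast
  ultimately have "(\<lambda>(x, t). A i x t) (restrict x {1..i}, \<lambda>j\<in>{1..<i}. t j)
      \<in> space (count_space {1..n - i + 1})"
    by (rule measurable_space[rotated])
  then show ?thesis by (simp only: prod.case space_count_space)
qed

lemma duration_range:
  assumes "online_algorithm n A" "i \<in> {1..n}" "uncovered A x i"
  shows "duration A x i \<in> {1..n - i + 1}"
  unfolding duration_eq[of A x i] if_P[OF assms(3)]
  by (rule online_algorithm_range[OF assms(1,2)])

lemma duration_le:
  assumes "online_algorithm n A" "i \<in> {1..n}"
  shows "duration A x i \<le> n"
proof (cases "uncovered A x i")
  case True
  then show ?thesis using duration_range[OF assms True] assms(2) by auto
next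
  case False
  then show ?thesis by (simp add: duration_eq)
qed

text \<open>Follows the recursion: the history map is measurable by induction and is composed with
  the jointly measurable rule. The index set \<open>I\<close> is free because both
  \<open>{1..<i}\<close> and \<open>{1..n}\<close> occur later.\<close>

lemma measurable_duration:
  assumes A: "online_algorithm n A" and I: "{1..i} \<subseteq> I" and "i \<in> {1..n}"
  shows "(\<lambda>x. duration A x i) \<in> (\<Pi>\<^sub>M j\<in>I. (borel :: real measure)) \<rightarrow>\<^sub>M count_space UNIV"
  using I \<open>i \<in> {1..n}\<close>
proof (induction i rule: less_induct)
  case (less i)
  let ?P = "\<Pi>\<^sub>M j\<in>I. (borel :: real measure)"
  have IH: "(\<lambda>x. duration A x j) \<in> ?P \<rightarrow>\<^sub>M count_space UNIV" if "j \<in> {1..<i}" for j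
    using that less.prems by (intro less.IH) auto
  have U: "Measurable.pred ?P (\<lambda>x. uncovered A x i)"
    unfolding uncovered_def
  proof (intro pred_intros_finite)
    fix j assume "j \<in> {1..<i}"
    from measurable_compose[OF IH[OF this], of "\<lambda>d. j + d - 1 < i" "count_space UNIV"]
    show "Measurable.pred ?P (\<lambda>x. j + duration A x j - 1 < i)" by simp
  qed auto
  have "(\<lambda>(x, t). A i x t) \<in>
       (\<Pi>\<^sub>M j\<in>{1..i}. (borel :: real measure)) \<Otimes>\<^sub>M (\<Pi>\<^sub>M j\<in>{1..<i}. count_space UNIV)
         \<rightarrow>\<^sub>M count_space {1..n - i + 1}"
    using A less.prems by (auto simp: online_algorithm_def)
  moreover have "(\<lambda>x. (restrict x {1..i}, \<lambda>j\<in>{1..<i}. duration A x j)) \<in> ?P \<rightarrow>\<^sub>M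
      (\<Pi>\<^sub>M j\<in>{1..i}. (borel :: real measure)) \<Otimes>\<^sub>M (\<Pi>\<^sub>M j\<in>{1..<i}. count_space UNIV)"
    using less.prems IH
    by (intro measurable_Pair measurable_restrict_subset measurable_restrict) auto
  ultimately have
    "(\<lambda>x. A i (restrict x {1..i}) (\<lambda>j\<in>{1..<i}. duration A x j)) \<in> ?P \<rightarrow>\<^sub>M count_space {1..n - i + 1}"
    by (auto dest: measurable_compose[rotated])
  \<comment> \<open>The target is enlarged because the value \<open>0\<close> of covered steps lies
    outside \<open>{1..n - i + 1}\<close>.\<close>
  then have "(\<lambda>x. A i (restrict x {1..i}) (\<lambda>j\<in>{1..<i}. duration A x j)) \<in> ?P \<rightarrow>\<^sub>M count_space UNIV"
    using measurable_compose[of _ ?P "count_space {1..n - i + 1}" "\<lambda>d. d" "count_space UNIV"] by simp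
  with U show ?case
    unfolding duration_eq[of A _ i] by (intro measurable_If) auto
qed

lemma measurable_uncovered:
  assumes A: "online_algorithm n A" and "{1..<i} \<subseteq> I" "i \<in> {1..n}"
  shows "Measurable.pred (\<Pi>\<^sub>M j\<in>I. (borel :: real measure)) (\<lambda>x. uncovered A x i)"
  unfolding uncovered_def
proof (intro pred_intros_finite)
  fix j assume "j \<in> {1..<i}"
  then have "(\<lambda>x. duration A x j) \<in> (\<Pi>\<^sub>M j\<in>I. (borel :: real measure)) \<rightarrow>\<^sub>M count_space UNIV"
    using assms by (intro measurable_duration[OF A]) auto
  from measurable_compose[OF this, of "\<lambda>d. j + d - 1 < i" "count_space UNIV"]
  show "Measurable.pred (\<Pi>\<^sub>M j\<in>I. (borel :: real measure)) (\<lambda>x. j + duration A x j - 1 < i)" by simp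
qed auto

text \<open>The sum of the first \<open>m\<close> durations is the last step covered by the first \<open>m\<close> choices.\<close>

lemma sum_duration:
  assumes "online_algorithm n A" "m \<le> n"
  shows "m \<le> (\<Sum>i=1..m. duration A x i)" "(\<Sum>i=1..m. duration A x i) \<le> n"
    "uncovered A x (Suc m) \<longleftrightarrow> (\<Sum>i=1..m. duration A x i) = m"
proof -
  let ?d = "duration A x" and ?S = "\<lambda>m. \<Sum>i=1..m. duration A x i"
  \<comment> \<open>The last two conjuncts make the sum the maximum of \<open>j + ?d j - 1\<close>,
    the last covered step; the disjunct \<open>m = 0\<close> stands for the empty maximum.\<close>
  have "m \<le> ?S m \<and> ?S m \<le> n \<and> (\<forall>j\<in>{1..m}. j + ?d j - 1 \<le> ?S m) \<and>
      (m = 0 \<or> (\<exists>j\<in>{1..m}. j + ?d j - 1 = ?S m))"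
    using \<open>m \<le> n\<close>
  proof (induction m)
    case 0
    show ?case by simp
  next
    case (Suc m)
    then have IH: "m \<le> ?S m" "?S m \<le> n" "\<And>j. j \<in> {1..m} \<Longrightarrow> j + ?d j - 1 \<le> ?S m"
      "m = 0 \<or> (\<exists>j\<in>{1..m}. j + ?d j - 1 = ?S m)"
      by auto
    show ?case
    proof (cases "uncovered A x (Suc m)")
      case True
      then have "j + ?d j - 1 \<le> m" if "j \<in> {1..m}" for j
        using bspec[of "{1..<Suc m}" _ j] that by (simp add: uncovered_def less_Suc_eq_le)
      then have "?S m \<le> m" using IH(4) by (cases "m = 0") (simp, metis)
      then have S: "?S m = m" using IH(1) by simp
      have d: "?d (Suc m) \<in> {1..n - m}"
        using duration_range[OF assms(1) _ True] Suc.prems by auto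
      \<comment> \<open>The new selection starts right after the \<open>m\<close> covered steps, so
        it ends at \<open>Suc m + ?d (Suc m) - 1\<close>, which is the new sum
        \<open>m + ?d (Suc m)\<close>.\<close>
      have "\<exists>j\<in>{1..Suc m}. j + ?d j - 1 = ?S (Suc m)"
        using S by (intro bexI[of _ "Suc m"]) auto
      moreover have "j + ?d j - 1 \<le> ?S (Suc m)" if "j \<in> {1..Suc m}" for j
        using that S IH(3)[of j] by (cases "j = Suc m") auto
      ultimately show ?thesis using S d Suc.prems by auto
    next
      case False
      then have d: "?d (Suc m) = 0" by (simp add: duration_eq)
      from False obtain j where "j \<in> {1..m}" "Suc m \<le> j + ?d j - 1"
        by (force simp: uncovered_def not_less)
      \<comment> \<open>The covering selection reaches beyond \<open>m\<close>, so the sum is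
        already at least \<open>Suc m\<close> and adding the duration \<open>0\<close> keeps the
        invariant.\<close>
      with IH(3)[of j] have "Suc m \<le> ?S m" by simp
      moreover have "m \<noteq> 0" using \<open>j \<in> {1..m}\<close> by auto
      then obtain l where "l \<in> {1..m}" "l + ?d l - 1 = ?S m" using IH(4) by auto
      moreover have "j + ?d j - 1 \<le> ?S m" if "j \<in> {1..Suc m}" for j
        using that d IH(1) IH(3)[of j] by (cases "j = Suc m") auto
      ultimately show ?thesis using d IH(2) by auto
    qed
  qed
  then have inv: "m \<le> ?S m" "?S m \<le> n" "\<And>j. j \<in> {1..m} \<Longrightarrow> j + ?d j - 1 \<le> ?S m"
      "m = 0 \<or> (\<exists>j\<in>{1..m}. j + ?d j - 1 = ?S m)"
    by blast+
  show "m \<le> ?S m" "?S m \<le> n" by fact+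
  show "uncovered A x (Suc m) \<longleftrightarrow> ?S m = m"
  proof
    assume "uncovered A x (Suc m)"
    then have "j + ?d j - 1 \<le> m" if "j \<in> {1..m}" for j
      using bspec[of "{1..<Suc m}" _ j] that by (simp add: uncovered_def less_Suc_eq_le)
    then have "?S m \<le> m" using inv(4) by (cases "m = 0") (simp, metis)
    then show "?S m = m" using inv(1) by simp
  next
    assume "?S m = m"
    show "uncovered A x (Suc m)"
      unfolding uncovered_def
    proof
      fix j assume "j \<in> {1..<Suc m}"
      then show "j + ?d j - 1 < Suc m" using inv(3)[of j] \<open>?S m = m\<close> by simp
    qed
  qed
qed

section \<open>Decomposition of the total value into surpluses\<close>

text \<open>The change in gain plus future value caused by the choice at an uncovered step
  \<open>i\<close>: \<open>Suc (n - i)\<close> counts the remaining steps including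
  \<open>i\<close>.\<close>

definition surplus :: "real measure \<Rightarrow> nat \<Rightarrow> rule \<Rightarrow> (nat \<Rightarrow> real) \<Rightarrow> nat \<Rightarrow> real" where
  "surplus D n A x i = x i * real (duration A x i)
     + stage_value D (Suc (n - i) - duration A x i) - stage_value D (Suc (n - i))"

lemma total_value_eq_surplus:
  assumes A: "online_algorithm n A"
  shows "total_value n A x
    = stage_value D n + (\<Sum>i=1..n. if uncovered A x i then surplus D n A x i else 0)"
proof -
  \<comment> \<open>The potential is the value secured by the first \<open>m\<close> choices plus
    the optimal value of the steps left free by them. It changes by the surplus at an uncovered step
    and not at all at a covered one.\<close>
  have "(\<Sum>i=1..m. x i * real (duration A x i)) + stage_value D (n - (\<Sum>i=1..m. duration A x i))
      = stage_value D n + (\<Sum>i=1..m. if uncovered A x i then surplus D n A x i else 0)"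
    if "m \<le> n" for m
    using that
  proof (induction m)
    case 0
    show ?case by simp
  next
    case (Suc m)
    show ?case
    proof (cases "uncovered A x (Suc m)")
      case True
      then have "(\<Sum>i=1..m. duration A x i) = m"
        using sum_duration(3)[OF A, of m x] Suc.prems by simp
      moreover from this have "(\<Sum>i=1..Suc m. duration A x i) = m + duration A x (Suc m)" by simp
      moreover have "Suc (n - Suc m) = n - m" using Suc.prems by simp
      ultimately show ?thesis
        using Suc True by (simp add: surplus_def)
    next
      case False
      then have "duration A x (Suc m) = 0" by (simp add: duration_eq)
      then show ?thesis using Suc False by simp
    qed
  qed
  \<comment> \<open>At \<open>m = n\<close> the sum of durations is squeezed to \<open>n\<close>, so
    the future term is \<open>stage_value D 0 = 0\<close>.\<close>
  from this[of n] show ?thesis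
    using sum_duration(1,2)[OF A, of n x] by (simp add: total_value_def)
qed

text \<open>By the recursion for \<open>stage_value\<close>, this has mean zero under \<open>D\<close>.\<close>

definition best_surplus :: "real measure \<Rightarrow> nat \<Rightarrow> real \<Rightarrow> real" where
  "best_surplus D m y = y + max (stage_value D m) (real m * y) - stage_value D (Suc m)"

text \<open>The first collected step is obligatory and yields \<open>x i\<close>; how many of the
  \<open>n - i\<close> later steps to add is the choice bounded by
  \<open>stage_choice_le\<close>.\<close>

lemma surplus_le:
  assumes D: "prob_space D" "integrable D (\<lambda>y. y)"
    and A: "online_algorithm n A" "i \<in> {1..n}" "uncovered A x i"
  shows "surplus D n A x i \<le> best_surplus D (n - i) (x i)"
proof -
  obtain s where s: "duration A x i = Suc s" "s \<le> n - i"
    using duration_range[OF A] by (cases "duration A x i") auto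
  have "real s * x i + stage_value D (n - i - s) \<le> max (stage_value D (n - i)) (real (n - i) * x i)"
    by (rule stage_choice_le[OF D s(2)])
  then show ?thesis
    using s by (simp add: surplus_def best_surplus_def algebra_simps del: stage_value.simps(2))
qed

lemma online_algorithm_threshold: "online_algorithm n (threshold_algorithm D n)"
  unfolding online_algorithm_def
proof
  fix i assume i: "i \<in> {1..n}"
  let ?Q = "(\<Pi>\<^sub>M j\<in>{1..i}. (borel :: real measure)) \<Otimes>\<^sub>M (\<Pi>\<^sub>M j\<in>{1..<i}. (count_space UNIV :: nat measure))"
  have "(\<lambda>x. x i) \<in> borel_measurable (\<Pi>\<^sub>M j\<in>{1..i}. (borel :: real measure))"
    using i by (intro measurable_component_singleton) auto
  then have "(\<lambda>p. fst p i) \<in> borel_measurable ?Q"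
    by (rule measurable_compose[OF measurable_fst])
  then have "Measurable.pred ?Q (\<lambda>p. fst p i > threshold D (n - i))"
    by simp
  then have "(\<lambda>p. if fst p i > threshold D (n - i) then n - i + 1 else 1)
      \<in> ?Q \<rightarrow>\<^sub>M count_space {1..n - i + 1}"
    by (intro measurable_If) auto
  then show "(\<lambda>(x, t). threshold_algorithm D n i x t) \<in> ?Q \<rightarrow>\<^sub>M count_space {1..n - i + 1}"
    by (simp add: threshold_algorithm_def case_prod_beta)
qed

text \<open>The comparison with the threshold, multiplied by \<open>n - i\<close>, selects the
  larger entry of the maximum in \<open>best_surplus\<close>. The premise \<open>opt\<close> ties
  the threshold to the recursion until the two are identified.\<close>

lemma surplus_threshold_algorithm:
  assumes i: "i \<in> {1..n}" and U: "uncovered (threshold_algorithm D n) x i"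
    and opt: "opt_value D (n - i) = stage_value D (n - i)"
  shows "surplus D n (threshold_algorithm D n) x i = best_surplus D (n - i) (x i)"
proof -
  define m where "m = n - i"
  have d: "duration (threshold_algorithm D n) x i = (if x i > threshold D m then Suc m else 1)"
    using i U by (simp add: duration_eq threshold_algorithm_def m_def)
  show ?thesis
  proof (cases "m = 0")
    \<comment> \<open>In the last step both branches of the rule choose duration
      \<open>1\<close>.\<close>
    case True
    then show ?thesis using d by (simp add: surplus_def best_surplus_def flip: m_def)
  next
    case False
    then have "x i > threshold D m \<longleftrightarrow> stage_value D m < real m * x i"
      using opt by (simp add: threshold_def field_simps flip: m_def)
    then show ?thesis
      using d by (simp add: surplus_def best_surplus_def algebra_simps flip: m_def del: stage_value.simps(2))
  qed
qed

section \<open>Expectations for independent draws\<close>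

context prob_space
begin

context
  fixes X :: "nat \<Rightarrow> 'a \<Rightarrow> real" and D :: "real measure" and n :: nat
  assumes indep: "indep_vars (\<lambda>_. borel) X {1..n}"
    and distr: "\<And>i. i \<in> {1..n} \<Longrightarrow> distr M borel (X i) = D"
    and D: "prob_space D" "integrable D (\<lambda>y. y)"
begin

lemma X_measurable: "i \<in> {1..n} \<Longrightarrow> X i \<in> borel_measurable M"
  using indep by (auto simp: indep_vars_def)

lemma X_restrict_measurable:
  "(\<lambda>\<omega>. restrict (\<lambda>i. X i \<omega>) {1..n}) \<in> M \<rightarrow>\<^sub>M (\<Pi>\<^sub>M j\<in>{1..n}. (borel :: real measure))"
  using X_measurable by (intro measurable_restrict) auto

lemma integrable_best_surplus: "integrable D (best_surplus D m)"
proof -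
  interpret D: prob_space D by fact
  show ?thesis
    unfolding best_surplus_def using integrable_stage[OF D, of _ m] by simp
qed

lemma expectation_best_surplus: "(\<integral>y. best_surplus D m y \<partial>D) = 0"
proof -
  interpret D: prob_space D by fact
  show ?thesis
    unfolding best_surplus_def using integrable_stage[OF D, of _ m] D.prob_space by simp
qed

lemma best_surplus_measurable: "best_surplus D m \<in> borel_measurable borel"
  unfolding best_surplus_def by simp

lemma X_integral:
  fixes h :: "real \<Rightarrow> real"
  assumes "i \<in> {1..n}" "integrable D h" "h \<in> borel_measurable borel"
  shows "integrable M (\<lambda>\<omega>. h (X i \<omega>))" "expectation (\<lambda>\<omega>. h (X i \<omega>)) = (\<integral>y. h y \<partial>D)"
proof -
  show "integrable M (\<lambda>\<omega>. h (X i \<omega>))"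
    using assms(2) integrable_distr_eq[OF X_measurable[OF assms(1)] assms(3)]
    by (simp only: distr[OF assms(1)])
  show "expectation (\<lambda>\<omega>. h (X i \<omega>)) = (\<integral>y. h y \<partial>D)"
    using integral_distr[OF X_measurable[OF assms(1)] assms(3)] by (simp only: distr[OF assms(1)])
qed

text \<open>The indicator depends on the draws before \<open>i\<close> and the other factor on
  \<open>X i\<close>; by independence the expectation factors, and the second factor has mean
  zero.\<close>

lemma uncovered_best_surplus:
  assumes A: "online_algorithm n A" and i: "i \<in> {1..n}"
  defines "Z \<equiv> \<lambda>\<omega>. if uncovered A (\<lambda>j. X j \<omega>) i then best_surplus D (n - i) (X i \<omega>) else 0"
  shows "integrable M Z" "expectation Z = 0"
proof -
  define u where "u = (\<lambda>x. if uncovered A x i then 1 else 0 :: real)"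
  define W where "W = (\<lambda>\<omega>. u (restrict (\<lambda>j. X j \<omega>) {1..<i}))"
  define V where "V = (\<lambda>\<omega>. best_surplus D (n - i) (X i \<omega>))"
  have u: "u \<in> borel_measurable (\<Pi>\<^sub>M j\<in>{1..<i}. (borel :: real measure))"
    unfolding u_def using measurable_uncovered[OF A _ i, of "{1..<i}"] by simp
  have v: "(\<lambda>x. best_surplus D (n - i) (x i)) \<in> borel_measurable (\<Pi>\<^sub>M j\<in>{i}. (borel :: real measure))"
    by (rule measurable_compose[OF _ best_surplus_measurable])
      (rule measurable_component_singleton, simp)
  have "indep_var (\<Pi>\<^sub>M j\<in>{1..<i}. borel) (\<lambda>\<omega>. restrict (\<lambda>j. X j \<omega>) {1..<i})
      (\<Pi>\<^sub>M j\<in>{i}. borel) (\<lambda>\<omega>. restrict (\<lambda>j. X j \<omega>) {i})"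
    using i by (intro indep_var_restrict[OF indep]) auto
  from indep_var_compose[OF this u v] have ind: "indep_var borel W borel V"
    by (simp add: W_def V_def comp_def)
  have W: "integrable M W"
  proof (rule integrable_const_bound[of _ 1])
    show "W \<in> borel_measurable M"
      unfolding W_def using i X_measurable
      by (intro measurable_compose[OF _ u] measurable_restrict) auto
  qed (simp add: W_def u_def)
  have V: "integrable M V" "expectation V = 0"
    unfolding V_def
    using X_integral[OF i integrable_best_surplus best_surplus_measurable] expectation_best_surplus
    by simp_all
  have "Z = (\<lambda>\<omega>. W \<omega> * V \<omega>)"
  proof
    fix \<omega>
    have "uncovered A (\<lambda>j. X j \<omega>) i = uncovered A (restrict (\<lambda>j. X j \<omega>) {1..<i}) i"
      by (rule uncovered_cong) simp
    then show "Z \<omega> = W \<omega> * V \<omega>"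
      by (simp add: Z_def W_def V_def u_def)
  qed
  then show "integrable M Z" "expectation Z = 0"
    using indep_var_integrable[OF ind W V(1)] indep_var_lebesgue_integral[OF ind W V(1)] V(2)
    by simp_all
qed

lemma integrable_total_value:
  assumes A: "online_algorithm n A"
  shows "integrable M (\<lambda>\<omega>. total_value n A (\<lambda>i. X i \<omega>))"
  unfolding total_value_def
proof (intro Bochner_Integration.integrable_sum)
  fix i assume i: "i \<in> {1..n}"
  have X: "integrable M (X i)"
    using X_integral(1)[OF i D(2)] by simp
  have "(\<lambda>\<omega>. duration A (restrict (\<lambda>j. X j \<omega>) {1..n}) i) \<in> M \<rightarrow>\<^sub>M count_space UNIV"
    using i by (intro measurable_compose[OF X_restrict_measurable] measurable_duration[OF A]) auto
  \<comment> \<open>Restriction puts the sample into the product space, where measurability is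
    known, without changing the durations up to step \<open>n\<close>.\<close>
  also have "(\<lambda>\<omega>. duration A (restrict (\<lambda>j. X j \<omega>) {1..n}) i) = (\<lambda>\<omega>. duration A (\<lambda>j. X j \<omega>) i)"
    using i by (intro ext duration_cong) auto
  finally have "(\<lambda>\<omega>. X i \<omega> * real (duration A (\<lambda>j. X j \<omega>) i)) \<in> borel_measurable M"
    using X_measurable[OF i] by (intro borel_measurable_times) auto
  then show "integrable M (\<lambda>\<omega>. X i \<omega> * real (duration A (\<lambda>j. X j \<omega>) i))"
  proof (rule Bochner_Integration.integrable_bound[rotated])
    show "integrable M (\<lambda>\<omega>. X i \<omega> * real n)" using X by simp
    show "AE \<omega> in M. norm (X i \<omega> * real (duration A (\<lambda>j. X j \<omega>) i)) \<le> norm (X i \<omega> * real n)"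
      using duration_le[OF A i] by (auto simp: abs_mult intro!: mult_left_mono)
  qed
qed

lemma expectation_sum_best_surplus:
  assumes A: "online_algorithm n A"
  defines "Y \<equiv> \<lambda>\<omega>. stage_value D n + (\<Sum>i=1..n. if uncovered A (\<lambda>j. X j \<omega>) i
      then best_surplus D (n - i) (X i \<omega>) else 0)"
  shows "integrable M Y" "expectation Y = stage_value D n"
proof -
  let ?Z = "\<lambda>i \<omega>. if uncovered A (\<lambda>j. X j \<omega>) i then best_surplus D (n - i) (X i \<omega>) else 0"
  have Z: "integrable M (\<lambda>\<omega>. \<Sum>i=1..n. ?Z i \<omega>)"
    using uncovered_best_surplus(1)[OF A] by (rule Bochner_Integration.integrable_sum)
  then show "integrable M Y"
    unfolding Y_def by simp
  have "expectation Y = stage_value D n + expectation (\<lambda>\<omega>. \<Sum>i=1..n. ?Z i \<omega>)"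
    unfolding Y_def using Z by (subst Bochner_Integration.integral_add) (simp_all add: prob_space)
  also have "expectation (\<lambda>\<omega>. \<Sum>i=1..n. ?Z i \<omega>) = (\<Sum>i=1..n. expectation (?Z i))"
    using uncovered_best_surplus(1)[OF A] by (rule Bochner_Integration.integral_sum)
  also have "\<dots> = 0"
    using uncovered_best_surplus(2)[OF A] by (intro sum.neutral) auto
  finally show "expectation Y = stage_value D n" by simp
qed

text \<open>Integrates the pointwise bound on the surpluses. The space carrying \<open>X\<close> is
  arbitrary, so the bound applies to \<open>M\<close> and to the canonical product behind
  \<open>opt_value\<close> alike.\<close>

lemma expected_value_le_stage_value:
  assumes A: "online_algorithm n A"
  shows "expected_value M X n A \<le> stage_value D n"
proof -
  have "expected_value M X n A \<le> expectation (\<lambda>\<omega>. stage_value D n +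
      (\<Sum>i=1..n. if uncovered A (\<lambda>j. X j \<omega>) i then best_surplus D (n - i) (X i \<omega>) else 0))"
    unfolding expected_value_def
  proof (rule integral_mono[OF integrable_total_value[OF A] expectation_sum_best_surplus(1)[OF A]])
    show "total_value n A (\<lambda>i. X i \<omega>) \<le> stage_value D n +
      (\<Sum>i=1..n. if uncovered A (\<lambda>j. X j \<omega>) i then best_surplus D (n - i) (X i \<omega>) else 0)" for \<omega>
      unfolding total_value_eq_surplus[OF A, of _ D]
      using surplus_le[OF D A] by (intro add_left_mono sum_mono) auto
  qed
  then show ?thesis using expectation_sum_best_surplus(2)[OF A] by simp
qed

text \<open>The thresholds that occur are those at \<open>n - i\<close> with
  \<open>i \<ge> 1\<close>, so the identification is assumed for \<open>k < n\<close>; this makes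
  strong induction possible.\<close>

lemma expected_value_threshold_algorithm:
  assumes opt: "\<And>k. k < n \<Longrightarrow> opt_value D k = stage_value D k"
  shows "expected_value M X n (threshold_algorithm D n) = stage_value D n"
proof -
  let ?A = "threshold_algorithm D n"
  have "total_value n ?A (\<lambda>i. X i \<omega>) = stage_value D n +
      (\<Sum>i=1..n. if uncovered ?A (\<lambda>j. X j \<omega>) i then best_surplus D (n - i) (X i \<omega>) else 0)" for \<omega>
    unfolding total_value_eq_surplus[OF online_algorithm_threshold[of n D], of _ D]
    using surplus_threshold_algorithm[of _ n D "\<lambda>j. X j \<omega>"] opt
    by (intro arg_cong2[where f="(+)"] sum.cong) auto
  then show ?thesis
    unfolding expected_value_def
    using expectation_sum_best_surplus(2)[OF online_algorithm_threshold] by simp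
qed

end

end

section \<open>Identification of the supremum with the recursion\<close>

text \<open>On the canonical product the upper bound is attained by the threshold algorithm, whose
  thresholds belong to shorter horizons and are known by induction. So the supremum is a
  maximum.\<close>

lemma opt_value_eq_stage_value:
  assumes D: "prob_space D" "integrable D (\<lambda>y. y)" and sets: "sets D = sets borel"
  shows "opt_value D k = stage_value D k"
proof (induction k rule: less_induct)
  case (less k)
  let ?P = "\<Pi>\<^sub>M j\<in>{1..k}. D"
  interpret P: prob_space ?P by (intro prob_space_PiM D(1))
  have distr: "distr ?P borel (\<lambda>\<omega>. \<omega> i) = D" if "i \<in> {1..k}" for i
  proof -
    have "distr ?P borel (\<lambda>\<omega>. \<omega> i) = distr ?P D (\<lambda>\<omega>. \<omega> i)"
      by (rule distr_cong) (simp_all add: sets)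
    also have "\<dots> = D"
      using that D(1) by (intro distr_PiM_component) auto
    finally show ?thesis .
  qed
  have rv: "(\<lambda>\<omega>. \<omega> i) \<in> borel_measurable ?P" if "i \<in> {1..k}" for i
    using measurable_component_singleton[OF that, of "\<lambda>_. D"] by (simp add: measurable_cong_sets[OF refl sets])
  have indep: "prob_space.indep_vars ?P (\<lambda>_. borel) (\<lambda>i \<omega>. \<omega> i) {1..k}"
  \<comment> \<open>The characterization of independence by the joint law is applied to a nonempty
    index set.\<close>
  proof (cases "k = 0")
    case True
    then show ?thesis unfolding P.indep_vars_def2 P.indep_sets_def by simp
  next
    case False
    \<comment> \<open>The joint law of the coordinates is the product itself: restriction is the
      identity on extensional functions, and \<open>D\<close> and \<open>borel\<close> have the same
      sets.\<close>
    have "distr ?P (\<Pi>\<^sub>M i\<in>{1..k}. borel) (\<lambda>\<omega>. \<lambda>i\<in>{1..k}. \<omega> i) = distr ?P ?P (\<lambda>\<omega>. \<omega>)"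
      by (intro distr_cong sets_PiM_cong)
        (auto simp: sets space_PiM PiE_def extensional_restrict)
    also have "\<dots> = ?P" by simp
    also have "\<dots> = (\<Pi>\<^sub>M i\<in>{1..k}. distr ?P borel (\<lambda>\<omega>. \<omega> i))"
      using distr by (intro PiM_cong) auto
    finally show ?thesis
      using False rv by (subst P.indep_vars_iff_distr_eq_PiM') auto
  qed
  note facts = indep distr D
  have thr: "expected_value ?P (\<lambda>i \<omega>. \<omega> i) k (threshold_algorithm D k) = stage_value D k"
    using P.expected_value_threshold_algorithm[OF facts] less.IH by blast
  show ?case
    unfolding opt_value_def
  proof (rule cSup_eq_maximum)
    show "stage_value D k \<in> (\<lambda>A. expected_value ?P (\<lambda>i \<omega>. \<omega> i) k A) ` Collect (online_algorithm k)"
      using thr online_algorithm_threshold[of k D] by (intro image_eqI[of _ _ "threshold_algorithm D k"]) auto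
  next
    fix v assume "v \<in> (\<lambda>A. expected_value ?P (\<lambda>i \<omega>. \<omega> i) k A) ` Collect (online_algorithm k)"
    then show "v \<le> stage_value D k"
      using P.expected_value_le_stage_value[OF facts] by blast
  qed
qed

theorem theorem1:
  fixes n :: nat
    and D :: "real measure"
    and f :: "real \<Rightarrow> real"
    and M :: "'a measure"
    and X :: "nat \<Rightarrow> 'a \<Rightarrow> real"
  assumes n_pos: "n > 0"
    and f_borel: "f \<in> borel_measurable lborel"
    and f_nonneg: "\<And>y. f y \<ge> 0"
    and D_density: "D = density lborel (\<lambda>y. ennreal (f y))"
    and D_prob: "prob_space D"
    and D_support: "cdf D 0 = 0"
    and D_finite_expectation: "integrable D (\<lambda>y. y)"
    and M_prob: "prob_space M"
    and X_indep: "prob_space.indep_vars M (\<lambda>_. borel) X {1..n}"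
    and X_distr: "\<And>i. i \<in> {1..n} \<Longrightarrow> distr M borel (X i) = D"
  shows "online_algorithm n (threshold_algorithm D n) \<and>
    expected_value M X n (threshold_algorithm D n) = opt_value D n \<and>
    (\<forall>A. online_algorithm n A \<longrightarrow>
       expected_value M X n A \<le> expected_value M X n (threshold_algorithm D n))"
proof -
  interpret prob_space M by fact
  \<comment> \<open>The density representation supplies \<open>sets D = sets borel\<close>.\<close>
  have opt: "opt_value D k = stage_value D k" for k
    using D_density by (intro opt_value_eq_stage_value D_prob D_finite_expectation) simp
  note facts = X_indep X_distr D_prob D_finite_expectation
  have thr: "expected_value M X n (threshold_algorithm D n) = stage_value D n"
    using expected_value_threshold_algorithm[OF facts] opt by blast
  then show ?thesis
    using expected_value_le_stage_value[OF facts] opt online_algorithm_threshold by simp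
qed

end
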